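(* Let $(Q,N,C_1,C_2,\dots)$ and $(\hat Q,\hat N,\hat C_1,\hat C_2,\dots)$ be real-valued random vectors with $N,\hat N\in\mathbb N\cup\{\infty\}$ ($\mathbb N=\{0,1,2,\dots\}$). Put $B_i=C_i1(N\ge i)$, $\hat B_i=\hat C_i1(\hat N\ge i)$ for $i\ge 1$, and let $\mu$, $\hat\mu$ be the laws of $(Q,B_1,B_2,\dots)$ and $(\hat Q,\hat B_1,\hat B_2,\dots)$. Assume $E[|Q|+\sum_{i\ge1}|B_i|]<\infty$ and $E[|\hat Q|+\sum_{i\ge 1}|\hat B_i|]<\infty$. Let $\pi$ be any coupling of $\mu$ and $\hat\mu$, and let $\{W^{(j)}:j\ge0\}$ and $\{\hat W^{(j)}:j\ge 0\}$ be the processes constructed on the two weighted branching processes that are coupled through $\pi$ (see context). Then for every $j\ge 0$, $$E\left[\left|\hat W^{(j)}-W^{(j)}\right|\right]\le\left(\hat\rho^{\,j}+E[|Q|]\sum_{t=0}^{j-1}\rho^t\hat\rho^{\,j-1-t}\right)\mathcal E,$$ where $\rho=E[\sum_{i=1}^N|C_i|]$, $\hat\rho=E[\sum_{i=1}^{\hat N}|\hat C_i|]$ and $\mathcal E=E_\pi\left[|\hat Q-Q|+\sum_{i=1}^\infty|\hat B_i-B_i|\right]$.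
   Context: Index set: $\mathbb N_+=\{1,2,\dots\}$, $U=\bigcup_{k\ge0}\mathbb N_+^k$ with $\mathbb N_+^0=\{\emptyset\}$; $(\mathbf i,j)$ denotes concatenation, with $(\emptyset,j)=j$. Coupled construction: let $\{(Q_{\mathbf i},B_{(\mathbf i,1)},B_{(\mathbf i,2)},\dots,\hat Q_{\mathbf i},\hat B_{(\mathbf i,1)},\hat B_{(\mathbf i,2)},\dots)\}_{\mathbf i\in U}$ be i.i.d. vectors with law $\pi$ (a probability measure whose two marginals are $\mu$ and $\hat\mu$). Set $\Pi_\emptyset=1$, $\Pi_{(\mathbf i,j)}=\Pi_{\mathbf i}B_{(\mathbf i,j)}$ and $$W^{(0)}=Q_\emptyset,\qquad W^{(j)}=\sum_{\mathbf i\in\mathbb N_+^j}Q_{\mathbf i}\Pi_{\mathbf i},\quad j\ge1;$$ define $\hat\Pi_{\mathbf i}$ and $\hat W^{(j)}$ in the same way from $\hat Q_{\mathbf i},\hat B_{\mathbf i}$. (This agrees with summing over the nodes of the $j$-th generation $A_j$ of the tree in which node $\mathbf i$ has $N_{\mathbf i}$ offspring and child $(\mathbf i,r)$ has weight $C_{(\mathbf i,r)}$, since $B_{(\mathbf i,r)}=C_{(\mathbf i,r)}1(N_{\mathbf i}\ge r)$.) $E_\pi$ is expectation for a single vector $(Q,B_1,\dots,\hat Q,\hat B_1,\dots)$ with law $\pi$. Conventions: $\sum_{i=a}^b x_i=0$ if $b<a$; $x^0=1$ for all $x$. *)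

theory Defs
  imports "HOL-Probability.Probability"
begin

text \<open>Nodes of the tree are finite words over the positive naturals; the concatenation
  \<open>(i, j)\<close> is \<open>i @ [j]\<close>.\<close>

definition generation :: "nat \<Rightarrow> nat list set" where
  "generation k = {i. length i = k \<and> set i \<subseteq> {1..}}"

definition nodes :: "nat list set" where
  "nodes = (\<Union>k. generation k)"

text \<open>The space of vectors \<open>(q, b 1, b 2, \<dots>)\<close>, with the product sigma-algebra. The sequence is
  indexed by the positive naturals, so its value at \<open>0\<close> carries no information
  (\<^const>\<open>PiM\<close> fixes it to \<^const>\<open>undefined\<close>).\<close>

definition vec_space :: "(real \<times> (nat \<Rightarrow> real)) measure" where
  "vec_space = borel \<Otimes>\<^sub>M (\<Pi>\<^sub>M i\<in>{1..}. borel)"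

definition vec :: "('a \<Rightarrow> real) \<Rightarrow> (nat \<Rightarrow> 'a \<Rightarrow> real) \<Rightarrow> 'a \<Rightarrow> real \<times> (nat \<Rightarrow> real)" where
  "vec Q B \<omega> = (Q \<omega>, \<lambda>i\<in>{1..}. B i \<omega>)"

definition law :: "'a measure \<Rightarrow> ('a \<Rightarrow> real) \<Rightarrow> (nat \<Rightarrow> 'a \<Rightarrow> real) \<Rightarrow> (real \<times> (nat \<Rightarrow> real)) measure"
  where "law M Q B = distr M vec_space (vec Q B)"

definition trunc :: "('a \<Rightarrow> enat) \<Rightarrow> (nat \<Rightarrow> 'a \<Rightarrow> real) \<Rightarrow> nat \<Rightarrow> 'a \<Rightarrow> real" where
  "trunc N C i \<omega> = C i \<omega> * of_bool (enat i \<le> N \<omega>)"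

definition is_coupling :: "'a measure \<Rightarrow> 'b measure \<Rightarrow> ('a \<times> 'b) measure \<Rightarrow> bool" where
  "is_coupling \<mu> \<nu> \<pi> \<longleftrightarrow>
     prob_space \<pi> \<and> sets \<pi> = sets (\<mu> \<Otimes>\<^sub>M \<nu>) \<and> distr \<pi> \<mu> fst = \<mu> \<and> distr \<pi> \<nu> snd = \<nu>"

text \<open>The coupled pair of weighted branching trees: the vector attached to node \<open>i\<close> consists of the
  \<open>Q\<close>-values at \<open>i\<close> and of the weights \<open>B\<close> of the children \<open>i @ [1], i @ [2], \<dots>\<close> of \<open>i\<close>.
  The root has no weight: \<open>B []\<close> is never used.\<close>

definition node_vec ::
  "(nat list \<Rightarrow> 'w \<Rightarrow> real) \<Rightarrow> (nat list \<Rightarrow> 'w \<Rightarrow> real) \<Rightarrow> nat list \<Rightarrow> 'w \<Rightarrow> real \<times> (nat \<Rightarrow> real)" where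
  "node_vec Q B i = vec (Q i) (\<lambda>j. B (i @ [j]))"

definition coupled_trees ::
  "'w measure \<Rightarrow> ((real \<times> (nat \<Rightarrow> real)) \<times> (real \<times> (nat \<Rightarrow> real))) measure \<Rightarrow>
   (nat list \<Rightarrow> 'w \<Rightarrow> real) \<Rightarrow> (nat list \<Rightarrow> 'w \<Rightarrow> real) \<Rightarrow>
   (nat list \<Rightarrow> 'w \<Rightarrow> real) \<Rightarrow> (nat list \<Rightarrow> 'w \<Rightarrow> real) \<Rightarrow> bool" where
  "coupled_trees P \<pi> Q B Q' B' \<longleftrightarrow>
     prob_space P \<and>
     prob_space.indep_vars P (\<lambda>_. vec_space \<Otimes>\<^sub>M vec_space)
       (\<lambda>i \<omega>. (node_vec Q B i \<omega>, node_vec Q' B' i \<omega>)) nodes \<and>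
     (\<forall>i\<in>nodes. distr P (vec_space \<Otimes>\<^sub>M vec_space)
       (\<lambda>\<omega>. (node_vec Q B i \<omega>, node_vec Q' B' i \<omega>)) = \<pi>)"

function path_weight :: "(nat list \<Rightarrow> 'w \<Rightarrow> real) \<Rightarrow> nat list \<Rightarrow> 'w \<Rightarrow> real" where
  "path_weight B [] \<omega> = 1"
| "path_weight B (i @ [j]) \<omega> = path_weight B i \<omega> * B (i @ [j]) \<omega>"
  by (auto, metis rev_exhaust)
termination by (relation "Wellfounded.measure (\<lambda>(B, i, \<omega>). length i)") auto

text \<open>\<^const>\<open>infsum\<close> is the unconditional sum, with value \<open>0\<close> where the family is not summable. When the
  generic vector has finite \<open>first_moment\<close> (defined below), the families
  are absolutely summable almost surely, so this convention only acts on a null set.\<close>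

definition W ::
  "(nat list \<Rightarrow> 'w \<Rightarrow> real) \<Rightarrow> (nat list \<Rightarrow> 'w \<Rightarrow> real) \<Rightarrow> nat \<Rightarrow> 'w \<Rightarrow> real" where
  "W Q B j \<omega> = (\<Sum>\<^sub>\<infinity>i\<in>generation j. Q i \<omega> * path_weight B i \<omega>)"

lemma W_0: "W Q B 0 \<omega> = Q [] \<omega>"
proof -
  have "generation 0 = {[]}"
    by (auto simp: generation_def)
  then show ?thesis
    by (simp add: W_def)
qed

text \<open>Expectations of nonnegative quantities are taken in \<^typ>\<open>ennreal\<close>, so that they are always
  defined; no integrability convention is involved.\<close>

definition first_moment :: "'a measure \<Rightarrow> ('a \<Rightarrow> real) \<Rightarrow> (nat \<Rightarrow> 'a \<Rightarrow> real) \<Rightarrow> ennreal" where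
  "first_moment M Q B =
     (\<integral>\<^sup>+\<omega>. ennreal \<bar>Q \<omega>\<bar> + (\<Sum>\<^sub>\<infinity>i\<in>{1..}. ennreal \<bar>B i \<omega>\<bar>) \<partial>M)"

definition offspring_mean :: "'a measure \<Rightarrow> ('a \<Rightarrow> enat) \<Rightarrow> (nat \<Rightarrow> 'a \<Rightarrow> real) \<Rightarrow> ennreal" where
  "offspring_mean M N C =
     (\<integral>\<^sup>+\<omega>. (\<Sum>\<^sub>\<infinity>i\<in>{i. 1 \<le> i \<and> enat i \<le> N \<omega>}. ennreal \<bar>C i \<omega>\<bar>) \<partial>M)"

definition coupling_cost ::
  "((real \<times> (nat \<Rightarrow> real)) \<times> (real \<times> (nat \<Rightarrow> real))) measure \<Rightarrow> ennreal" where
  "coupling_cost \<pi> =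
     (\<integral>\<^sup>+((q, b), (q', b')). ennreal \<bar>q' - q\<bar> + (\<Sum>\<^sub>\<infinity>i\<in>{1..}. ennreal \<bar>b' i - b i\<bar>) \<partial>\<pi>)"

end

theory Submission
  imports Defs "HOL-Library.Sublist"
begin

text \<open>Write \<open>\<Pi>\<close> for \<^const>\<open>path_weight\<close>. The bounds
  \<open>\<bar>Q' \<Pi>' - Q \<Pi>\<bar> \<le> \<bar>\<Pi>'\<bar> \<bar>Q' - Q\<bar> + \<bar>\<Pi>' - \<Pi>\<bar> \<bar>Q\<bar>\<close> at a node and
  \<open>\<bar>\<Pi>' b' - \<Pi> b\<bar> \<le> \<bar>\<Pi>'\<bar> \<bar>b' - b\<bar> + \<bar>\<Pi>' - \<Pi>\<bar> \<bar>b\<bar>\<close> from a node to its children have terms whose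
  first factors depend only on the vectors at proper ancestors of the node, hence are independent
  of the second factors. Summing over a generation and taking expectations, \<open>\<Sum> \<bar>\<Pi>'\<bar>\<close> has mean
  \<open>\<rho>' ^ k\<close>, and the mean \<open>D k\<close> of \<open>\<Sum> \<bar>\<Pi>' - \<Pi>\<bar>\<close> satisfies \<open>D (k + 1) \<le> \<rho>' ^ k * \<E> + D k * \<rho>\<close>.\<close>

subsection \<open>Countable sums of nonnegative terms\<close>

text \<open>Extended nonnegative families are always summable, so along an enumeration of
  \<open>A\<close> both sides become the same series. The counting-measure form gives access to
  Tonelli and to the measurability of sums that depend on a parameter.\<close>

lemma infsum_ennreal_eq_nn_integral:
  fixes f :: "'i \<Rightarrow> ennreal"
  assumes "countable A"
  shows "infsum f A = (\<integral>\<^sup>+i. f i \<partial>count_space A)"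
proof (cases "finite A")
  case True
  then show ?thesis
    by (simp add: nn_integral_count_space_finite)
next
  case False
  have bij: "bij_betw (from_nat_into A) UNIV A"
    using assms False by (rule bij_betw_from_nat_into)
  have "infsum f A = (\<Sum>\<^sub>\<infinity>n. f (from_nat_into A n))"
    by (rule infsum_reindex_bij_betw[OF bij, symmetric])
  also have "\<dots> = (\<Sum>n. f (from_nat_into A n))"
    by (intro sums_unique has_sum_imp_sums has_sum_infsum nonneg_summable_on_complete) simp
  also have "\<dots> = (\<integral>\<^sup>+i. f i \<partial>count_space A)"
    by (simp add: nn_integral_bij_count_space[OF bij, symmetric] nn_integral_count_space_nat)
  finally show ?thesis .
qed

lemma summable_on_if_nn_integral_finite:
  fixes f :: "'i \<Rightarrow> real"
  assumes "(\<integral>\<^sup>+i. ennreal \<bar>f i\<bar> \<partial>count_space A) < \<infinity>"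
  shows "f summable_on A"
proof -
  have "integrable (count_space A) f"
    using assms by (simp add: integrable_iff_bounded)
  then have "(\<lambda>i. norm (f i)) summable_on A"
    by (simp only: abs_summable_equivalent Infinite_Set_Sum.abs_summable_on_def)
  then show ?thesis
    by (rule abs_summable_summable)
qed

text \<open>The triangle inequality settles the summable case; otherwise \<open>infsum\<close> has
  the value 0 and the bound is trivial.\<close>

lemma abs_infsum_le_nn_integral:
  fixes f :: "'i \<Rightarrow> real"
  assumes "countable A"
  shows "ennreal \<bar>infsum f A\<bar> \<le> (\<integral>\<^sup>+i. ennreal \<bar>f i\<bar> \<partial>count_space A)"
proof (cases "f summable_on A")
  case True
  then have abs: "(\<lambda>i. \<bar>f i\<bar>) summable_on A"
    using summable_on_iff_abs_summable_on_real[of f A] by simp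
  have "ennreal \<bar>infsum f A\<bar> \<le> ennreal (\<Sum>\<^sub>\<infinity>i\<in>A. \<bar>f i\<bar>)"
    using norm_infsum_bound[of f A] abs by (intro ennreal_leI) simp
  also have "\<dots> = infsum (ennreal \<circ> (\<lambda>i. \<bar>f i\<bar>)) A"
    by (rule infsum_comm_additive_general[symmetric]) (use abs in \<open>simp_all add: o_def sum_ennreal\<close>)
  finally show ?thesis
    by (simp add: infsum_ennreal_eq_nn_integral[OF assms] o_def)
next
  case False
  then show ?thesis
    by (simp add: infsum_not_exists)
qed

text \<open>Countability of \<open>A\<close> makes the uncurried family jointly measurable and the
  counting measure sigma-finite, so integrating out the index keeps measurability.\<close>

lemma borel_measurable_nn_integral_count_space:
  assumes "countable A" "\<And>i. i \<in> A \<Longrightarrow> f i \<in> borel_measurable M"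
  shows "(\<lambda>x. \<integral>\<^sup>+i. f i x \<partial>count_space A) \<in> borel_measurable M"
proof -
  interpret sigma_finite_measure "count_space A"
    using assms(1) by (rule sigma_finite_measure_count_space_countable)
  have "(\<lambda>(i, x). f i x) \<in> borel_measurable (count_space A \<Otimes>\<^sub>M M)"
    using assms by (intro measurable_pair_measure_countable1) auto
  from measurable_compose[OF measurable_pair_swap' this]
  show ?thesis
    by (intro borel_measurable_nn_integral) (simp add: split_def)
qed

text \<open>Of the two possible splittings, this one puts the primed path weight on the local error
  and the unprimed entry \<open>y\<close> on the accumulated error. Hence the powers of \<rho>' and,
  respectively, the factors \<rho> and E|Q| in the final bound.\<close>

lemma abs_diff_mult_le:
  fixes p q x y :: real
  shows "ennreal \<bar>p * x - q * y\<bar> \<le> ennreal \<bar>p\<bar> * ennreal \<bar>x - y\<bar> + ennreal \<bar>p - q\<bar> * ennreal \<bar>y\<bar>"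
proof -
  have "p * x - q * y = p * (x - y) + (p - q) * y"
    by (simp add: algebra_simps)
  then have "\<bar>p * x - q * y\<bar> \<le> \<bar>p\<bar> * \<bar>x - y\<bar> + \<bar>p - q\<bar> * \<bar>y\<bar>"
    by (metis abs_mult abs_triangle_ineq)
  then have "ennreal \<bar>p * x - q * y\<bar> \<le> ennreal (\<bar>p\<bar> * \<bar>x - y\<bar> + \<bar>p - q\<bar> * \<bar>y\<bar>)"
    by (rule ennreal_leI)
  then show ?thesis
    by (simp add: ennreal_mult)
qed

subsection \<open>Nodes and path weights\<close>

lemma generation_0: "generation 0 = {[]}"
  by (auto simp: generation_def)

lemma generation_Suc: "generation (Suc k) = (\<lambda>(i, j). i @ [j]) ` (generation k \<times> {1..})"
proof (intro equalityI subsetI)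
  fix l assume "l \<in> generation (Suc k)"
  then show "l \<in> (\<lambda>(i, j). i @ [j]) ` (generation k \<times> {1..})"
    by (cases l rule: rev_cases) (auto simp: generation_def)
qed (auto simp: generation_def)

lemma countable_generation [simp]: "countable (generation k)"
  by (induction k) (auto simp: generation_0 generation_Suc)

lemma generation_subset_nodes: "i \<in> generation k \<Longrightarrow> i \<in> nodes"
  by (auto simp: nodes_def)

lemma nodes_iff: "i \<in> nodes \<longleftrightarrow> set i \<subseteq> {1..}"
  by (auto simp: nodes_def generation_def)

lemma strict_prefix_in_nodes: "i \<in> nodes \<Longrightarrow> strict_prefix l i \<Longrightarrow> l \<in> nodes"
  using set_mono_prefix by (fastforce simp: nodes_iff strict_prefix_def)

text \<open>A node of generation \<open>Suc k\<close> splits uniquely into its parent and its last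
  letter; Tonelli then gives the iterated sum.\<close>

lemma nn_integral_generation_Suc:
  fixes f :: "nat list \<Rightarrow> ennreal"
  shows "(\<integral>\<^sup>+l. f l \<partial>count_space (generation (Suc k))) =
    (\<integral>\<^sup>+i. \<integral>\<^sup>+j. f (i @ [j]) \<partial>count_space {1..} \<partial>count_space (generation k))"
proof -
  interpret sigma_finite_measure "count_space {1::nat..}"
    by (rule sigma_finite_measure_count_space_countable) simp
  have prod: "count_space (generation k \<times> {1::nat..}) =
    count_space (generation k) \<Otimes>\<^sub>M count_space {1..}"
    by (rule pair_measure_countable[symmetric]) simp_all
  have "bij_betw (\<lambda>(i, j). i @ [j]) (generation k \<times> {1..}) (generation (Suc k))"
    by (auto simp: bij_betw_def inj_on_def generation_Suc)
  from nn_integral_bij_count_space[OF this, of f, symmetric]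
  have "(\<integral>\<^sup>+l. f l \<partial>count_space (generation (Suc k))) =
    (\<integral>\<^sup>+(i, j). f (i @ [j]) \<partial>count_space (generation k \<times> {1..}))"
    by (simp only: split_def)
  also have "\<dots> = (\<integral>\<^sup>+(i, j). f (i @ [j]) \<partial>(count_space (generation k) \<Otimes>\<^sub>M count_space {1..}))"
    by (simp only: prod)
  \<comment> \<open>The product is itself a counting measure space, so every function on it is
    measurable.\<close>
  also have "\<dots> = (\<integral>\<^sup>+i. \<integral>\<^sup>+j. f (i @ [j]) \<partial>count_space {1..} \<partial>count_space (generation k))"
    by (subst nn_integral_fst[symmetric]) (simp_all only: prod[symmetric] measurable_count_space_eq1
        space_borel Pi_UNIV UNIV_I prod.case)
  finally show ?thesis .
qed

text \<open>The path weight as a function of the family \<open>x\<close> of node vectors, where \<open>b j v\<close> is the weight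
  which the vector \<open>v\<close> gives to the \<open>j\<close>-th child.\<close>

definition weight :: "(nat \<Rightarrow> 's \<Rightarrow> real) \<Rightarrow> nat list \<Rightarrow> (nat list \<Rightarrow> 's) \<Rightarrow> real" where
  "weight b i x = path_weight (\<lambda>l x. b (last l) (x (butlast l))) i x"

lemma weight_Nil [simp]: "weight b [] x = 1"
  by (simp add: weight_def)

lemma weight_snoc [simp]: "weight b (i @ [j]) x = weight b i x * b j (x i)"
  by (simp add: weight_def)

text \<open>Agreement with \<open>b\<close> is asked for at nodes only, since \<open>vec\<close>
  carries no information at index 0.\<close>

lemma path_weight_eq_weight:
  assumes "i \<in> nodes" "\<And>i j. i @ [j] \<in> nodes \<Longrightarrow> B (i @ [j]) \<omega> = b j (x i)"
  shows "path_weight B i \<omega> = weight b i x"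
  using assms(1) by (induction i rule: rev_induct) (auto simp: assms(2) nodes_iff)

text \<open>The weight of \<open>i\<close> is a product of entries read from vectors at strict
  ancestors, never from the vector at \<open>i\<close> itself. All independence below rests on
  this.\<close>

lemma weight_cong:
  "(\<And>l. strict_prefix l i \<Longrightarrow> x l = y l) \<Longrightarrow> weight b i x = weight b i y"
proof (induction i rule: rev_induct)
  case (snoc j i)
  have "strict_prefix l (i @ [j])" if "l = i \<or> strict_prefix l i" for l
    using that by (auto simp: strict_prefix_def)
  then show ?case
    using snoc by auto
qed simp

text \<open>\<open>A\<close> may exceed the set of strict ancestors, so that the induction can pass
  to a shorter prefix while the product space stays fixed.\<close>

lemma weight_measurable:
  assumes "i \<in> nodes" "\<forall>j\<ge>1. b j \<in> borel_measurable S" "{l. strict_prefix l i} \<subseteq> A"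
  shows "weight b i \<in> borel_measurable (PiM A (\<lambda>_. S))"
  using assms(1,3)
proof (induction i rule: rev_induct)
  case (snoc j i)
  have sub: "{l. strict_prefix l i} \<subseteq> A" "i \<in> A" and "i \<in> nodes" "j \<ge> 1"
    using snoc.prems by (auto simp: strict_prefix_def nodes_iff)
  have "b j \<in> borel_measurable S"
    using \<open>j \<ge> 1\<close> assms(2) by simp
  with measurable_component_singleton[OF \<open>i \<in> A\<close>, of "\<lambda>_. S"]
  have "(\<lambda>x. b j (x i)) \<in> borel_measurable (PiM A (\<lambda>_. S))"
    by (rule measurable_compose)
  moreover have "weight b (i @ [j]) = (\<lambda>x. weight b i x * b j (x i))"
    by (simp add: fun_eq_iff)
  ultimately show ?case
    using snoc.IH[OF \<open>i \<in> nodes\<close> sub(1)] by simp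
next
  case Nil
  have "weight b [] = (\<lambda>_. 1)"
    by (simp add: fun_eq_iff)
  then show ?case
    by simp
qed

subsection \<open>Trees of i.i.d. vectors\<close>

text \<open>A single vector \<open>X i\<close> in an abstract space stands for the coupled pair at
  node \<open>i\<close>. The two trees differ only in the coordinate maps (\<open>q\<close>,
  \<open>b\<close> against \<open>q'\<close>, \<open>b'\<close>) that read from it.\<close>

locale iid_tree = prob_space P for P :: "'w measure" +
  fixes S :: "'s measure" and \<pi> :: "'s measure" and X :: "nat list \<Rightarrow> 'w \<Rightarrow> 's"
  assumes indep: "indep_vars (\<lambda>_. S) X nodes"
    and distr: "i \<in> nodes \<Longrightarrow> distr P S (X i) = \<pi>"
begin

lemma X_measurable: "i \<in> nodes \<Longrightarrow> X i \<in> measurable P S"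
  using indep by (auto simp: indep_vars_def)

lemma nn_integral_node:
  "i \<in> nodes \<Longrightarrow> g \<in> borel_measurable S \<Longrightarrow> (\<integral>\<^sup>+\<omega>. g (X i \<omega>) \<partial>P) = (\<integral>\<^sup>+v. g v \<partial>\<pi>)"
  by (simp add: distr[symmetric] nn_integral_distr X_measurable)

lemma weight_random_variable:
  assumes "i \<in> nodes" "\<forall>j\<ge>1. b j \<in> borel_measurable S"
  shows "(\<lambda>\<omega>. weight b i (\<lambda>l. X l \<omega>)) \<in> borel_measurable P"
proof -
  let ?A = "{l. strict_prefix l i}"
  \<comment> \<open>Points of the product space are extensional, so the family is first restricted
    to the strict ancestors; \<open>weight_cong\<close> removes the restriction afterwards.\<close>
  have "(\<lambda>\<omega>. \<lambda>l\<in>?A. X l \<omega>) \<in> measurable P (PiM ?A (\<lambda>_. S))"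
    using assms(1) by (intro measurable_restrict X_measurable) (auto intro: strict_prefix_in_nodes)
  from measurable_compose[OF this weight_measurable[OF assms order_refl]]
  have "(\<lambda>\<omega>. weight b i (\<lambda>l\<in>?A. X l \<omega>)) \<in> borel_measurable P" .
  also have "(\<lambda>\<omega>. weight b i (\<lambda>l\<in>?A. X l \<omega>)) = (\<lambda>\<omega>. weight b i (\<lambda>l. X l \<omega>))"
    by (intro ext weight_cong) auto
  finally show ?thesis .
qed

text \<open>Both weights are functions of the vectors at strict ancestors of \<open>i\<close>, an
  index set disjoint from \<open>{i}\<close>, so independence factors the expectation. Leaving
  \<open>h\<close> general covers the absolute weight as well as the absolute difference of the two
  weights.\<close>

lemma nn_integral_weight_mult_node:
  fixes h :: "real \<Rightarrow> real \<Rightarrow> ennreal" and g :: "'s \<Rightarrow> ennreal"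
  assumes i: "i \<in> nodes"
    and b: "\<forall>j\<ge>1. b j \<in> borel_measurable S"
    and b': "\<forall>j\<ge>1. b' j \<in> borel_measurable S"
    and h: "case_prod h \<in> borel_measurable (borel \<Otimes>\<^sub>M borel)"
    and g: "g \<in> borel_measurable S"
  shows "(\<integral>\<^sup>+\<omega>. h (weight b i (\<lambda>l. X l \<omega>)) (weight b' i (\<lambda>l. X l \<omega>)) * g (X i \<omega>) \<partial>P) =
    (\<integral>\<^sup>+\<omega>. h (weight b i (\<lambda>l. X l \<omega>)) (weight b' i (\<lambda>l. X l \<omega>)) \<partial>P) * (\<integral>\<^sup>+v. g v \<partial>\<pi>)"
proof -
  let ?A = "{l. strict_prefix l i}"
  let ?H = "\<lambda>x. h (weight b i x) (weight b' i x)"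
  have H: "?H \<in> borel_measurable (PiM ?A (\<lambda>_. S))"
    using measurable_compose[OF measurable_Pair[OF weight_measurable[OF i b order_refl]
      weight_measurable[OF i b' order_refl]] h] by simp
  have G: "(\<lambda>x. g (x i)) \<in> borel_measurable (PiM {i} (\<lambda>_. S))"
    by (rule measurable_compose[OF measurable_component_singleton[where M = "\<lambda>_. S"] g]) simp
  have "indep_var (PiM ?A (\<lambda>_. S)) (\<lambda>\<omega>. \<lambda>l\<in>?A. X l \<omega>) (PiM {i} (\<lambda>_. S)) (\<lambda>\<omega>. \<lambda>l\<in>{i}. X l \<omega>)"
    using i by (intro indep_var_restrict[OF indep]) (auto intro: strict_prefix_in_nodes)
  from indep_var_compose[OF this H G]
  have "indep_var borel (\<lambda>\<omega>. ?H (\<lambda>l\<in>?A. X l \<omega>)) borel (\<lambda>\<omega>. g (X i \<omega>))"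
    by (simp add: o_def)
  moreover have "?H (\<lambda>l\<in>?A. X l \<omega>) = ?H (\<lambda>l. X l \<omega>)" for \<omega>
    by (intro arg_cong2[where f = h] weight_cong) auto
  ultimately have ind: "indep_var borel (\<lambda>\<omega>. ?H (\<lambda>l. X l \<omega>)) borel (\<lambda>\<omega>. g (X i \<omega>))"
    by simp
  \<comment> \<open>The pair is viewed as a family indexed by the booleans, the form to which the
    product formula for nonnegative integrals applies.\<close>
  then have "indep_vars (\<lambda>_. borel) (case_bool (\<lambda>\<omega>. ?H (\<lambda>l. X l \<omega>)) (\<lambda>\<omega>. g (X i \<omega>))) UNIV"
    by (simp add: indep_var_def case_bool_if)
  from indep_vars_nn_integral[OF _ this] nn_integral_node[OF i g] show ?thesis
    by (simp add: UNIV_bool mult.commute)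
qed

text \<open>Tonelli moves the expectation inside the sum, where the factorisation holds node by
  node. The second factor is the same at every node because all vectors have law \<pi>, so it can be
  pulled out.\<close>

lemma nn_integral_generation_weight_mult:
  fixes h :: "real \<Rightarrow> real \<Rightarrow> ennreal" and g :: "'s \<Rightarrow> ennreal"
  assumes b: "\<forall>j\<ge>1. b j \<in> borel_measurable S"
    and b': "\<forall>j\<ge>1. b' j \<in> borel_measurable S"
    and h: "case_prod h \<in> borel_measurable (borel \<Otimes>\<^sub>M borel)"
    and g: "g \<in> borel_measurable S"
  shows "(\<integral>\<^sup>+\<omega>. \<integral>\<^sup>+i. h (weight b i (\<lambda>l. X l \<omega>)) (weight b' i (\<lambda>l. X l \<omega>)) * g (X i \<omega>)
      \<partial>count_space (generation k) \<partial>P) =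
    (\<integral>\<^sup>+\<omega>. \<integral>\<^sup>+i. h (weight b i (\<lambda>l. X l \<omega>)) (weight b' i (\<lambda>l. X l \<omega>))
      \<partial>count_space (generation k) \<partial>P) * (\<integral>\<^sup>+v. g v \<partial>\<pi>)"
    (is "(\<integral>\<^sup>+\<omega>. \<integral>\<^sup>+i. ?H i \<omega> * _ \<partial>_ \<partial>P) = _")
proof -
  have H: "?H i \<in> borel_measurable P" if "i \<in> generation k" for i
    using measurable_compose[OF measurable_Pair[OF weight_random_variable[OF _ b]
      weight_random_variable[OF _ b']] h] generation_subset_nodes[OF that] by simp
  have G: "(\<lambda>\<omega>. g (X i \<omega>)) \<in> borel_measurable P" if "i \<in> generation k" for i
    using measurable_compose[OF X_measurable g] generation_subset_nodes[OF that] .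
  have "(\<integral>\<^sup>+\<omega>. \<integral>\<^sup>+i. ?H i \<omega> * g (X i \<omega>) \<partial>count_space (generation k) \<partial>P) =
    (\<integral>\<^sup>+i. \<integral>\<^sup>+\<omega>. ?H i \<omega> * g (X i \<omega>) \<partial>P \<partial>count_space (generation k))"
    using H G by (intro nn_integral_count_space_nn_integral) auto
  also have "\<dots> = (\<integral>\<^sup>+i. (\<integral>\<^sup>+\<omega>. ?H i \<omega> \<partial>P) * (\<integral>\<^sup>+v. g v \<partial>\<pi>) \<partial>count_space (generation k))"
    by (intro nn_integral_cong nn_integral_weight_mult_node b b' h g)
      (simp_all add: generation_subset_nodes)
  also have "\<dots> = (\<integral>\<^sup>+i. \<integral>\<^sup>+\<omega>. ?H i \<omega> \<partial>P \<partial>count_space (generation k)) * (\<integral>\<^sup>+v. g v \<partial>\<pi>)"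
    by (rule nn_integral_multc) simp
  also have "(\<integral>\<^sup>+i. \<integral>\<^sup>+\<omega>. ?H i \<omega> \<partial>P \<partial>count_space (generation k)) =
    (\<integral>\<^sup>+\<omega>. \<integral>\<^sup>+i. ?H i \<omega> \<partial>count_space (generation k) \<partial>P)"
    using H by (intro nn_integral_count_space_nn_integral[symmetric]) auto
  finally show ?thesis .
qed

text \<open>For the coordinate maps of the two trees this is \<rho> and \<rho>'; for their
  difference it is the part of the coupling cost that comes from the weights.\<close>

definition offspring_weight :: "(nat \<Rightarrow> 's \<Rightarrow> real) \<Rightarrow> ennreal" where
  "offspring_weight b = (\<integral>\<^sup>+v. \<integral>\<^sup>+j. ennreal \<bar>b j v\<bar> \<partial>count_space {1..} \<partial>\<pi>)"

text \<open>Summing over the children of a node multiplies its absolute weight by an independent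
  factor of mean \<open>offspring_weight b\<close>, so each generation contributes one more
  factor.\<close>

lemma nn_integral_generation_abs_weight:
  assumes b: "\<forall>j\<ge>1. b j \<in> borel_measurable S"
  shows "(\<integral>\<^sup>+\<omega>. \<integral>\<^sup>+i. ennreal \<bar>weight b i (\<lambda>l. X l \<omega>)\<bar> \<partial>count_space (generation k) \<partial>P) =
    offspring_weight b ^ k"
proof (induction k)
  case 0
  then show ?case
    by (simp add: generation_0 nn_integral_count_space_finite emeasure_space_1)
next
  case (Suc k)
  have "(\<lambda>v. \<integral>\<^sup>+j. ennreal \<bar>b j v\<bar> \<partial>count_space {1..}) \<in> borel_measurable S"
    using b by (intro borel_measurable_nn_integral_count_space) auto
  from nn_integral_generation_weight_mult[where h = "\<lambda>p _. ennreal \<bar>p\<bar>", OF b b _ this]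
  show ?case
    by (simp add: nn_integral_generation_Suc abs_mult ennreal_mult nn_integral_cmult Suc.IH)
      (simp add: offspring_weight_def mult.commute)
qed

text \<open>This is the common core of two estimates: with \<open>F\<close> the sum over the
  children of a node it gives the recursion for the weight differences, and with \<open>F\<close>
  the difference of the summands of the two processes it gives the final bound.\<close>

lemma nn_integral_generation_diff_le:
  fixes F :: "nat list \<Rightarrow> 'w \<Rightarrow> ennreal" and g g' :: "'s \<Rightarrow> ennreal"
  assumes b: "\<forall>j\<ge>1. b j \<in> borel_measurable S"
    and b': "\<forall>j\<ge>1. b' j \<in> borel_measurable S"
    and g: "g \<in> borel_measurable S" and g': "g' \<in> borel_measurable S"
    and F: "\<And>i \<omega>. i \<in> generation k \<Longrightarrow> F i \<omega> \<le> ennreal \<bar>weight b' i (\<lambda>l. X l \<omega>)\<bar> * g' (X i \<omega>) +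
      ennreal \<bar>weight b' i (\<lambda>l. X l \<omega>) - weight b i (\<lambda>l. X l \<omega>)\<bar> * g (X i \<omega>)"
  shows "(\<integral>\<^sup>+\<omega>. \<integral>\<^sup>+i. F i \<omega> \<partial>count_space (generation k) \<partial>P) \<le>
    offspring_weight b' ^ k * (\<integral>\<^sup>+v. g' v \<partial>\<pi>) +
    (\<integral>\<^sup>+\<omega>. \<integral>\<^sup>+i. ennreal \<bar>weight b' i (\<lambda>l. X l \<omega>) - weight b i (\<lambda>l. X l \<omega>)\<bar>
      \<partial>count_space (generation k) \<partial>P) * (\<integral>\<^sup>+v. g v \<partial>\<pi>)"
proof -
  let ?w = "\<lambda>i \<omega>. weight b i (\<lambda>l. X l \<omega>)" and ?w' = "\<lambda>i \<omega>. weight b' i (\<lambda>l. X l \<omega>)"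
  let ?F1 = "\<lambda>i \<omega>. ennreal \<bar>?w' i \<omega>\<bar> * g' (X i \<omega>)"
  let ?F2 = "\<lambda>i \<omega>. ennreal \<bar>?w' i \<omega> - ?w i \<omega>\<bar> * g (X i \<omega>)"
  note [measurable] = weight_random_variable[OF _ b] weight_random_variable[OF _ b']
    measurable_compose[OF X_measurable g] measurable_compose[OF X_measurable g']
  have [measurable]: "?F1 i \<in> borel_measurable P" "?F2 i \<in> borel_measurable P"
    if "i \<in> generation k" for i
    using generation_subset_nodes[OF that] by measurable
  have "(\<integral>\<^sup>+\<omega>. \<integral>\<^sup>+i. F i \<omega> \<partial>count_space (generation k) \<partial>P) \<le>
    (\<integral>\<^sup>+\<omega>. \<integral>\<^sup>+i. ?F1 i \<omega> + ?F2 i \<omega> \<partial>count_space (generation k) \<partial>P)"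
    by (intro nn_integral_mono F) simp
  also have "\<dots> = (\<integral>\<^sup>+\<omega>. (\<integral>\<^sup>+i. ?F1 i \<omega> \<partial>count_space (generation k)) +
      (\<integral>\<^sup>+i. ?F2 i \<omega> \<partial>count_space (generation k)) \<partial>P)"
    by (simp add: nn_integral_add)
  also have "\<dots> = (\<integral>\<^sup>+\<omega>. \<integral>\<^sup>+i. ?F1 i \<omega> \<partial>count_space (generation k) \<partial>P) +
      (\<integral>\<^sup>+\<omega>. \<integral>\<^sup>+i. ?F2 i \<omega> \<partial>count_space (generation k) \<partial>P)"
    by (intro nn_integral_add borel_measurable_nn_integral_count_space) simp_all
  also have "(\<integral>\<^sup>+\<omega>. \<integral>\<^sup>+i. ?F1 i \<omega> \<partial>count_space (generation k) \<partial>P) =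
      offspring_weight b' ^ k * (\<integral>\<^sup>+v. g' v \<partial>\<pi>)"
    using nn_integral_generation_weight_mult[where h = "\<lambda>_ p. ennreal \<bar>p\<bar>", OF b b' _ g']
      nn_integral_generation_abs_weight[OF b'] by simp
  also have "(\<integral>\<^sup>+\<omega>. \<integral>\<^sup>+i. ?F2 i \<omega> \<partial>count_space (generation k) \<partial>P) =
      (\<integral>\<^sup>+\<omega>. \<integral>\<^sup>+i. ennreal \<bar>?w' i \<omega> - ?w i \<omega>\<bar> \<partial>count_space (generation k) \<partial>P) * (\<integral>\<^sup>+v. g v \<partial>\<pi>)"
    using nn_integral_generation_weight_mult[where h = "\<lambda>p p'. ennreal \<bar>p' - p\<bar>", OF b b' _ g]
    by simp
  finally show ?thesis .
qed

text \<open>The recursion is unrolled from generation 0, where both weights are 1 and the difference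
  vanishes. Only the weight part of the cost enters here.\<close>

lemma nn_integral_generation_weight_diff_le:
  assumes b: "\<forall>j\<ge>1. b j \<in> borel_measurable S"
    and b': "\<forall>j\<ge>1. b' j \<in> borel_measurable S"
  shows "(\<integral>\<^sup>+\<omega>. \<integral>\<^sup>+i. ennreal \<bar>weight b' i (\<lambda>l. X l \<omega>) - weight b i (\<lambda>l. X l \<omega>)\<bar>
      \<partial>count_space (generation k) \<partial>P) \<le>
    (\<Sum>t<k. offspring_weight b ^ t * offspring_weight b' ^ (k - 1 - t)) *
    offspring_weight (\<lambda>j v. b' j v - b j v)"
proof (induction k)
  case 0
  then show ?case
    by (simp add: generation_0 nn_integral_count_space_finite)
next
  case (Suc k)
  let ?r = "offspring_weight b" and ?r' = "offspring_weight b'"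
    and ?e = "offspring_weight (\<lambda>j v. b' j v - b j v)"
  let ?w = "\<lambda>i \<omega>. weight b i (\<lambda>l. X l \<omega>)" and ?w' = "\<lambda>i \<omega>. weight b' i (\<lambda>l. X l \<omega>)"
  let ?D = "\<lambda>k. \<integral>\<^sup>+\<omega>. \<integral>\<^sup>+i. ennreal \<bar>?w' i \<omega> - ?w i \<omega>\<bar> \<partial>count_space (generation k) \<partial>P"
  let ?g = "\<lambda>v. \<integral>\<^sup>+j. ennreal \<bar>b j v\<bar> \<partial>count_space {1..}"
    and ?g' = "\<lambda>v. \<integral>\<^sup>+j. ennreal \<bar>b' j v - b j v\<bar> \<partial>count_space {1..}"
  have "?g \<in> borel_measurable S" "?g' \<in> borel_measurable S"
    using b b' by (auto intro!: borel_measurable_nn_integral_count_space borel_measurable_diff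
        measurable_compose[OF _ measurable_ennreal] borel_measurable_abs)
  then have "?D (Suc k) \<le> ?r' ^ k * (\<integral>\<^sup>+v. ?g' v \<partial>\<pi>) + ?D k * (\<integral>\<^sup>+v. ?g v \<partial>\<pi>)"
    unfolding nn_integral_generation_Suc
  proof (rule nn_integral_generation_diff_le[OF b b'])
    fix i \<omega>
    let ?v = "X i \<omega>"
    have "(\<integral>\<^sup>+j. ennreal \<bar>?w' (i @ [j]) \<omega> - ?w (i @ [j]) \<omega>\<bar> \<partial>count_space {1..}) \<le>
      (\<integral>\<^sup>+j. ennreal \<bar>?w' i \<omega>\<bar> * ennreal \<bar>b' j ?v - b j ?v\<bar> +
        ennreal \<bar>?w' i \<omega> - ?w i \<omega>\<bar> * ennreal \<bar>b j ?v\<bar> \<partial>count_space {1..})"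
      by (intro nn_integral_mono) (simp add: abs_diff_mult_le)
    also have "\<dots> = ennreal \<bar>?w' i \<omega>\<bar> * ?g' ?v + ennreal \<bar>?w' i \<omega> - ?w i \<omega>\<bar> * ?g ?v"
      by (simp add: nn_integral_add nn_integral_cmult)
    finally show "(\<integral>\<^sup>+j. ennreal \<bar>?w' (i @ [j]) \<omega> - ?w (i @ [j]) \<omega>\<bar> \<partial>count_space {1..}) \<le> \<dots>" .
  qed
  also have "\<dots> = ?D k * ?r + ?r' ^ k * ?e"
    by (simp add: offspring_weight_def add.commute)
  also have "\<dots> \<le> (\<Sum>t<k. ?r ^ t * ?r' ^ (k - 1 - t)) * ?e * ?r + ?r' ^ k * ?e"
    by (intro add_right_mono mult_right_mono Suc.IH) simp
  \<comment> \<open>Multiplication by \<open>?r\<close> shifts the summation index by one, and the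
    new term with \<open>?r' ^ k\<close> becomes the summand at \<open>t = 0\<close>.\<close>
  also have "\<dots> = (\<Sum>t<Suc k. ?r ^ t * ?r' ^ (Suc k - 1 - t)) * ?e"
    unfolding sum.lessThan_Suc_shift
    by (simp add: sum_distrib_left sum_distrib_right distrib_left mult_ac add.commute)
  finally show ?case .
qed

text \<open>Finiteness makes the families almost surely summable, so that \<^const>\<open>infsum\<close> does not take its
  junk value.\<close>

lemma AE_generation_summable:
  assumes b: "\<forall>j\<ge>1. b j \<in> borel_measurable S"
    and q: "q \<in> borel_measurable S"
    and fin: "(\<integral>\<^sup>+v. ennreal \<bar>q v\<bar> \<partial>\<pi>) < \<infinity>" "offspring_weight b < \<infinity>"
  shows "AE \<omega> in P. (\<lambda>i. q (X i \<omega>) * weight b i (\<lambda>l. X l \<omega>)) summable_on generation k"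
proof -
  let ?w = "\<lambda>i \<omega>. weight b i (\<lambda>l. X l \<omega>)"
  have q': "(\<lambda>v. ennreal \<bar>q v\<bar>) \<in> borel_measurable S"
    using q by measurable
  have "(\<integral>\<^sup>+\<omega>. \<integral>\<^sup>+i. ennreal \<bar>?w i \<omega>\<bar> * ennreal \<bar>q (X i \<omega>)\<bar> \<partial>count_space (generation k) \<partial>P) =
    offspring_weight b ^ k * (\<integral>\<^sup>+v. ennreal \<bar>q v\<bar> \<partial>\<pi>)"
    using nn_integral_generation_weight_mult[where h = "\<lambda>p _. ennreal \<bar>p\<bar>", OF b b _ q']
      nn_integral_generation_abs_weight[OF b] by simp
  also have "\<dots> < \<infinity>"
    using fin by (simp add: ennreal_mult_less_top power_less_top_ennreal)
  finally have "AE \<omega> in P. (\<integral>\<^sup>+i. ennreal \<bar>?w i \<omega>\<bar> * ennreal \<bar>q (X i \<omega>)\<bar>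
      \<partial>count_space (generation k)) \<noteq> \<infinity>"
    using weight_random_variable[OF _ b] measurable_compose[OF X_measurable q']
    by (intro nn_integral_PInf_AE borel_measurable_nn_integral_count_space)
      (auto simp: generation_subset_nodes)
  then show ?thesis
  proof eventually_elim
    case (elim \<omega>)
    then show ?case
      by (intro summable_on_if_nn_integral_finite)
        (simp add: abs_mult ennreal_mult mult.commute top.not_eq_extremum)
  qed
qed

text \<open>Almost sure summability merges the two sums into one sum of differences, which is
  bounded termwise. The moment assumptions enter only through this summability.\<close>

lemma nn_integral_generation_infsum_diff_le:
  assumes b: "\<forall>j\<ge>1. b j \<in> borel_measurable S"
    and b': "\<forall>j\<ge>1. b' j \<in> borel_measurable S"
    and q: "q \<in> borel_measurable S" and q': "q' \<in> borel_measurable S"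
    and fin: "(\<integral>\<^sup>+v. ennreal \<bar>q v\<bar> \<partial>\<pi>) < \<infinity>" "offspring_weight b < \<infinity>"
    and fin': "(\<integral>\<^sup>+v. ennreal \<bar>q' v\<bar> \<partial>\<pi>) < \<infinity>" "offspring_weight b' < \<infinity>"
  shows "(\<integral>\<^sup>+\<omega>. ennreal \<bar>(\<Sum>\<^sub>\<infinity>i\<in>generation k. q' (X i \<omega>) * weight b' i (\<lambda>l. X l \<omega>)) -
      (\<Sum>\<^sub>\<infinity>i\<in>generation k. q (X i \<omega>) * weight b i (\<lambda>l. X l \<omega>))\<bar> \<partial>P) \<le>
    offspring_weight b' ^ k * (\<integral>\<^sup>+v. ennreal \<bar>q' v - q v\<bar> \<partial>\<pi>) +
    (\<Sum>t<k. offspring_weight b ^ t * offspring_weight b' ^ (k - 1 - t)) *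
    offspring_weight (\<lambda>j v. b' j v - b j v) * (\<integral>\<^sup>+v. ennreal \<bar>q v\<bar> \<partial>\<pi>)"
proof -
  let ?f = "\<lambda>i \<omega>. q (X i \<omega>) * weight b i (\<lambda>l. X l \<omega>)"
    and ?f' = "\<lambda>i \<omega>. q' (X i \<omega>) * weight b' i (\<lambda>l. X l \<omega>)"
  have "(\<integral>\<^sup>+\<omega>. ennreal \<bar>infsum (\<lambda>i. ?f' i \<omega>) (generation k) - infsum (\<lambda>i. ?f i \<omega>) (generation k)\<bar> \<partial>P)
    \<le> (\<integral>\<^sup>+\<omega>. \<integral>\<^sup>+i. ennreal \<bar>?f' i \<omega> - ?f i \<omega>\<bar> \<partial>count_space (generation k) \<partial>P)"
  proof (rule nn_integral_mono_AE)
    from AE_generation_summable[OF b q fin, where k = k] AE_generation_summable[OF b' q' fin', where k = k]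
    show "AE \<omega> in P. ennreal \<bar>infsum (\<lambda>i. ?f' i \<omega>) (generation k) - infsum (\<lambda>i. ?f i \<omega>) (generation k)\<bar>
      \<le> (\<integral>\<^sup>+i. ennreal \<bar>?f' i \<omega> - ?f i \<omega>\<bar> \<partial>count_space (generation k))"
    proof eventually_elim
      case (elim \<omega>)
      \<comment> \<open>Summability of both families matters here: if just one failed, its
        \<open>infsum\<close> would be 0 and the identity could break.\<close>
      then have "infsum (\<lambda>i. ?f' i \<omega>) (generation k) - infsum (\<lambda>i. ?f i \<omega>) (generation k) =
        infsum (\<lambda>i. ?f' i \<omega> - ?f i \<omega>) (generation k)"
        using infsum_add[of "\<lambda>i. ?f' i \<omega>" "generation k" "\<lambda>i. - ?f i \<omega>"]
        by (simp add: summable_on_uminus infsum_uminus)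
      then show ?case
        by (simp add: abs_infsum_le_nn_integral)
    qed
  qed
  also have "\<dots> \<le> offspring_weight b' ^ k * (\<integral>\<^sup>+v. ennreal \<bar>q' v - q v\<bar> \<partial>\<pi>) +
    (\<integral>\<^sup>+\<omega>. \<integral>\<^sup>+i. ennreal \<bar>weight b' i (\<lambda>l. X l \<omega>) - weight b i (\<lambda>l. X l \<omega>)\<bar>
      \<partial>count_space (generation k) \<partial>P) * (\<integral>\<^sup>+v. ennreal \<bar>q v\<bar> \<partial>\<pi>)"
  proof (rule nn_integral_generation_diff_le[OF b b'])
    show "(\<lambda>v. ennreal \<bar>q v\<bar>) \<in> borel_measurable S" "(\<lambda>v. ennreal \<bar>q' v - q v\<bar>) \<in> borel_measurable S"
      using q q' by measurable
    fix i \<omega>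
    show "ennreal \<bar>?f' i \<omega> - ?f i \<omega>\<bar> \<le>
      ennreal \<bar>weight b' i (\<lambda>l. X l \<omega>)\<bar> * ennreal \<bar>q' (X i \<omega>) - q (X i \<omega>)\<bar> +
      ennreal \<bar>weight b' i (\<lambda>l. X l \<omega>) - weight b i (\<lambda>l. X l \<omega>)\<bar> * ennreal \<bar>q (X i \<omega>)\<bar>"
      using abs_diff_mult_le[of "weight b' i (\<lambda>l. X l \<omega>)" "q' (X i \<omega>)"
        "weight b i (\<lambda>l. X l \<omega>)" "q (X i \<omega>)"]
      by (simp only: mult.commute)
  qed
  also have "\<dots> \<le> offspring_weight b' ^ k * (\<integral>\<^sup>+v. ennreal \<bar>q' v - q v\<bar> \<partial>\<pi>) +
    (\<Sum>t<k. offspring_weight b ^ t * offspring_weight b' ^ (k - 1 - t)) *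
    offspring_weight (\<lambda>j v. b' j v - b j v) * (\<integral>\<^sup>+v. ennreal \<bar>q v\<bar> \<partial>\<pi>)"
    by (intro add_left_mono mult_right_mono nn_integral_generation_weight_diff_le b b') simp_all
  finally show ?thesis .
qed

end

subsection \<open>Laws and couplings\<close>

lemma vec_space_measurable [measurable]:
  "fst \<in> borel_measurable vec_space"
  "j \<ge> 1 \<Longrightarrow> (\<lambda>v. snd v j) \<in> borel_measurable vec_space"
  by (simp_all add: vec_space_def)

lemma sets_law [simp, measurable_cong]: "sets (law M Q B) = sets vec_space"
  by (simp add: law_def)

lemma trunc_measurable [measurable]:
  assumes [measurable]: "N \<in> measurable M (count_space UNIV)" "C i \<in> borel_measurable M"
  shows "trunc N C i \<in> borel_measurable M"
  unfolding trunc_def by measurable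

lemma nn_integral_law:
  assumes "Q \<in> borel_measurable M" "\<forall>i\<ge>1. B i \<in> borel_measurable M"
    and "f \<in> borel_measurable vec_space"
  shows "(\<integral>\<^sup>+v. f v \<partial>law M Q B) = (\<integral>\<^sup>+\<omega>. f (vec Q B \<omega>) \<partial>M)"
proof -
  have "vec Q B \<in> measurable M vec_space"
    unfolding vec_space_def vec_def[abs_def]
    using assms(1,2) by (intro measurable_Pair measurable_restrict) auto
  then show ?thesis
    using assms(3) by (simp add: law_def nn_integral_distr)
qed

text \<open>The random index set is replaced by the fixed set of positive indices, since
  \<open>trunc\<close> vanishes on the added ones.\<close>

lemma offspring_mean_eq:
  "offspring_mean M N C = (\<integral>\<^sup>+\<omega>. \<integral>\<^sup>+i. ennreal \<bar>trunc N C i \<omega>\<bar> \<partial>count_space {1..} \<partial>M)"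
  unfolding offspring_mean_def infsum_ennreal_eq_nn_integral[OF countableI_type]
proof (rule nn_integral_cong)
  fix \<omega>
  let ?I = "{i. 1 \<le> i \<and> enat i \<le> N \<omega>}"
  have "(\<integral>\<^sup>+i. ennreal \<bar>C i \<omega>\<bar> \<partial>count_space ?I) =
    (\<integral>\<^sup>+i. ennreal \<bar>trunc N C i \<omega>\<bar> \<partial>count_space ?I)"
    by (intro nn_integral_cong) (simp add: trunc_def)
  also have "\<dots> = (\<integral>\<^sup>+i. ennreal \<bar>trunc N C i \<omega>\<bar> \<partial>count_space {1..})"
    by (rule nn_integral_count_space_eq) (auto simp: trunc_def)
  finally show "(\<integral>\<^sup>+i. ennreal \<bar>C i \<omega>\<bar> \<partial>count_space ?I) = \<dots>" .
qed

text \<open>The splitting turns a finite first moment into finiteness of E|Q| and of the offspring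
  mean separately.\<close>

lemma first_moment_eq:
  assumes "Q \<in> borel_measurable M" "\<forall>i\<ge>1. B i \<in> borel_measurable M"
  shows "first_moment M Q B = (\<integral>\<^sup>+\<omega>. ennreal \<bar>Q \<omega>\<bar> \<partial>M) +
    (\<integral>\<^sup>+\<omega>. \<integral>\<^sup>+i. ennreal \<bar>B i \<omega>\<bar> \<partial>count_space {1..} \<partial>M)"
  unfolding first_moment_def infsum_ennreal_eq_nn_integral[OF countableI_type]
  using assms by (intro nn_integral_add borel_measurable_nn_integral_count_space) auto

text \<open>Expectations that involve one coordinate of the pair depend only on its marginal. This
  brings E|Q|, \<rho> and \<rho>', defined on the original spaces, under \<pi>.\<close>

lemma nn_integral_coupling:
  assumes "is_coupling \<mu> \<nu> \<pi>"
  shows "f \<in> borel_measurable \<mu> \<Longrightarrow> (\<integral>\<^sup>+v. f (fst v) \<partial>\<pi>) = (\<integral>\<^sup>+v. f v \<partial>\<mu>)"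
    and "g \<in> borel_measurable \<nu> \<Longrightarrow> (\<integral>\<^sup>+v. g (snd v) \<partial>\<pi>) = (\<integral>\<^sup>+v. g v \<partial>\<nu>)"
proof -
  have sets: "sets \<pi> = sets (\<mu> \<Otimes>\<^sub>M \<nu>)"
    and \<mu>: "distr \<pi> \<mu> fst = \<mu>" and \<nu>: "distr \<pi> \<nu> snd = \<nu>"
    using assms by (auto simp: is_coupling_def)
  note [measurable_cong] = sets
  show "(\<integral>\<^sup>+v. f (fst v) \<partial>\<pi>) = (\<integral>\<^sup>+v. f v \<partial>\<mu>)" if "f \<in> borel_measurable \<mu>"
    using nn_integral_distr[of fst \<pi> \<mu> f] that by (simp add: \<mu>)
  show "(\<integral>\<^sup>+v. g (snd v) \<partial>\<pi>) = (\<integral>\<^sup>+v. g v \<partial>\<nu>)" if "g \<in> borel_measurable \<nu>"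
    using nn_integral_distr[of snd \<pi> \<nu> g] that by (simp add: \<nu>)
qed

text \<open>The map \<open>p\<close> selects one component of the coupled pair, so that both
  processes become functionals of the same family \<open>x\<close>.\<close>

lemma W_eq_infsum_weight:
  assumes "\<And>l. p (x l) = node_vec Q B l \<omega>"
  shows "W Q B k \<omega> =
    (\<Sum>\<^sub>\<infinity>i\<in>generation k. fst (node_vec Q B i \<omega>) * weight (\<lambda>j v. snd (p v) j) i x)"
  unfolding W_def
proof (rule infsum_cong)
  fix i assume "i \<in> generation k"
  then have "path_weight B i \<omega> = weight (\<lambda>j v. snd (p v) j) i x"
    by (intro path_weight_eq_weight generation_subset_nodes)
      (auto simp: assms node_vec_def vec_def nodes_iff)
  then show "Q i \<omega> * path_weight B i \<omega> =
      fst (node_vec Q B i \<omega>) * weight (\<lambda>j v. snd (p v) j) i x"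
    by (simp add: node_vec_def vec_def)
qed

theorem proposition4p1:
  fixes M :: "'a measure" and M' :: "'b measure" and P :: "'w measure"
    and Q :: "'a \<Rightarrow> real" and N :: "'a \<Rightarrow> enat" and C :: "nat \<Rightarrow> 'a \<Rightarrow> real"
    and Q' :: "'b \<Rightarrow> real" and N' :: "'b \<Rightarrow> enat" and C' :: "nat \<Rightarrow> 'b \<Rightarrow> real"
    and \<pi> :: "((real \<times> (nat \<Rightarrow> real)) \<times> (real \<times> (nat \<Rightarrow> real))) measure"
    and Qn Bn Qn' Bn' :: "nat list \<Rightarrow> 'w \<Rightarrow> real"
    and \<rho> \<rho>' \<E> :: ennreal and j :: nat
  assumes "prob_space M" and "prob_space M'"
    and "Q \<in> borel_measurable M" and "N \<in> measurable M (count_space UNIV)"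
    and "\<And>i. i \<ge> 1 \<Longrightarrow> C i \<in> borel_measurable M"
    and "Q' \<in> borel_measurable M'" and "N' \<in> measurable M' (count_space UNIV)"
    and "\<And>i. i \<ge> 1 \<Longrightarrow> C' i \<in> borel_measurable M'"
    and "first_moment M Q (trunc N C) < \<infinity>"
    and "first_moment M' Q' (trunc N' C') < \<infinity>"
    and "is_coupling (law M Q (trunc N C)) (law M' Q' (trunc N' C')) \<pi>"
    and "coupled_trees P \<pi> Qn Bn Qn' Bn'"
    and "\<rho> = offspring_mean M N C" and "\<rho>' = offspring_mean M' N' C'"
    and "\<E> = coupling_cost \<pi>"
  shows "(\<integral>\<^sup>+\<omega>. ennreal \<bar>W Qn' Bn' j \<omega> - W Qn Bn j \<omega>\<bar> \<partial>P)
    \<le> (\<rho>' ^ j + (\<integral>\<^sup>+\<omega>. ennreal \<bar>Q \<omega>\<bar> \<partial>M) * (\<Sum>t<j. \<rho> ^ t * \<rho>' ^ (j - 1 - t))) * \<E>"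
proof -
  let ?S = "vec_space \<Otimes>\<^sub>M vec_space"
  let ?X = "\<lambda>i \<omega>. (node_vec Qn Bn i \<omega>, node_vec Qn' Bn' i \<omega>)"
  let ?q = "\<lambda>v :: (real \<times> (nat \<Rightarrow> real)) \<times> (real \<times> (nat \<Rightarrow> real)). fst (fst v)"
    and ?q' = "\<lambda>v :: (real \<times> (nat \<Rightarrow> real)) \<times> (real \<times> (nat \<Rightarrow> real)). fst (snd v)"
  let ?b = "\<lambda>j (v :: (real \<times> (nat \<Rightarrow> real)) \<times> (real \<times> (nat \<Rightarrow> real))). snd (fst v) j"
    and ?b' = "\<lambda>j (v :: (real \<times> (nat \<Rightarrow> real)) \<times> (real \<times> (nat \<Rightarrow> real))). snd (snd v) j"
  interpret iid_tree P ?S \<pi> ?X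
    using assms(12) by (simp add: iid_tree_def iid_tree_axioms_def coupled_trees_def)
  note cpl = nn_integral_coupling[OF assms(11)]
  have B: "\<forall>i\<ge>1. trunc N C i \<in> borel_measurable M"
    using assms(4,5) by (auto intro: trunc_measurable)
  have B': "\<forall>i\<ge>1. trunc N' C' i \<in> borel_measurable M'"
    using assms(7,8) by (auto intro: trunc_measurable)
  have marginal: "(\<integral>\<^sup>+v. f (fst v) \<partial>\<pi>) = (\<integral>\<^sup>+\<omega>. f (vec Q (trunc N C) \<omega>) \<partial>M)"
    if "f \<in> borel_measurable vec_space" for f
    using cpl(1)[where f = f] nn_integral_law[OF assms(3) B that] that
    by (simp add: measurable_cong_sets[OF sets_law refl])
  have marginal': "(\<integral>\<^sup>+v. f (snd v) \<partial>\<pi>) = (\<integral>\<^sup>+\<omega>. f (vec Q' (trunc N' C') \<omega>) \<partial>M')"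
    if "f \<in> borel_measurable vec_space" for f
    using cpl(2)[where g = f] nn_integral_law[OF assms(6) B' that] that
    by (simp add: measurable_cong_sets[OF sets_law refl])
  have b: "\<forall>j\<ge>1. ?b j \<in> borel_measurable ?S" "\<forall>j\<ge>1. ?b' j \<in> borel_measurable ?S"
    by (auto intro: measurable_compose[OF measurable_fst vec_space_measurable(2)]
        measurable_compose[OF measurable_snd vec_space_measurable(2)])
  have q: "?q \<in> borel_measurable ?S" "?q' \<in> borel_measurable ?S"
    by measurable
  have sum: "(\<lambda>v. \<integral>\<^sup>+j. ennreal \<bar>snd v j\<bar> \<partial>count_space {1..}) \<in> borel_measurable vec_space"
    by (intro borel_measurable_nn_integral_count_space) auto
  have Eq: "(\<integral>\<^sup>+v. ennreal \<bar>?q v\<bar> \<partial>\<pi>) = (\<integral>\<^sup>+\<omega>. ennreal \<bar>Q \<omega>\<bar> \<partial>M)"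
    using marginal[of "\<lambda>v. ennreal \<bar>fst v\<bar>"] by (simp add: vec_def)
  have Eq': "(\<integral>\<^sup>+v. ennreal \<bar>?q' v\<bar> \<partial>\<pi>) = (\<integral>\<^sup>+\<omega>. ennreal \<bar>Q' \<omega>\<bar> \<partial>M')"
    using marginal'[of "\<lambda>v. ennreal \<bar>fst v\<bar>"] by (simp add: vec_def)
  have Eb: "offspring_weight ?b = \<rho>"
    unfolding offspring_weight_def assms(13) offspring_mean_eq marginal[OF sum]
    by (intro nn_integral_cong) (simp add: vec_def)
  have Eb': "offspring_weight ?b' = \<rho>'"
    unfolding offspring_weight_def assms(14) offspring_mean_eq marginal'[OF sum]
    by (intro nn_integral_cong) (simp add: vec_def)
  have fin: "(\<integral>\<^sup>+\<omega>. ennreal \<bar>Q \<omega>\<bar> \<partial>M) < \<infinity>" "\<rho> < \<infinity>"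
    using assms(9) first_moment_eq[OF assms(3) B] by (simp_all add: assms(13) offspring_mean_eq)
  have fin': "(\<integral>\<^sup>+\<omega>. ennreal \<bar>Q' \<omega>\<bar> \<partial>M') < \<infinity>" "\<rho>' < \<infinity>"
    using assms(10) first_moment_eq[OF assms(6) B'] by (simp_all add: assms(14) offspring_mean_eq)
  let ?eq = "\<integral>\<^sup>+v. ennreal \<bar>?q' v - ?q v\<bar> \<partial>\<pi>" and ?eb = "offspring_weight (\<lambda>j v. ?b' j v - ?b j v)"
  have "\<E> = (\<integral>\<^sup>+v. ennreal \<bar>?q' v - ?q v\<bar> + (\<integral>\<^sup>+j. ennreal \<bar>?b' j v - ?b j v\<bar> \<partial>count_space {1..}) \<partial>\<pi>)"
    by (simp add: assms(15) coupling_cost_def split_def infsum_ennreal_eq_nn_integral)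
  \<comment> \<open>The cost is the sum of these two parts; bounding each by the whole yields the
    common factor \<E>.\<close>
  then have "?eq \<le> \<E>" "?eb \<le> \<E>"
    by (auto simp: offspring_weight_def intro!: nn_integral_mono)
  have "(\<integral>\<^sup>+\<omega>. ennreal \<bar>W Qn' Bn' j \<omega> - W Qn Bn j \<omega>\<bar> \<partial>P) \<le> \<rho>' ^ j * ?eq +
      (\<Sum>t<j. \<rho> ^ t * \<rho>' ^ (j - 1 - t)) * ?eb * (\<integral>\<^sup>+\<omega>. ennreal \<bar>Q \<omega>\<bar> \<partial>M)"
    \<comment> \<open>The family of pairs is projected by \<open>fst\<close> for the original tree
      and by \<open>snd\<close> for the primed one.\<close>
    using nn_integral_generation_infsum_diff_le[where k = j, OF b q] fin fin'
    by (simp add: Eq Eq' Eb Eb' W_eq_infsum_weight[where p = fst and x = "\<lambda>i. ?X i _"]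
      W_eq_infsum_weight[where p = snd and x = "\<lambda>i. ?X i _"])
  also have "\<dots> \<le> \<rho>' ^ j * \<E> + (\<Sum>t<j. \<rho> ^ t * \<rho>' ^ (j - 1 - t)) * \<E> * (\<integral>\<^sup>+\<omega>. ennreal \<bar>Q \<omega>\<bar> \<partial>M)"
    using \<open>?eq \<le> \<E>\<close> \<open>?eb \<le> \<E>\<close> by (intro add_mono mult_left_mono mult_right_mono) simp_all
  finally show ?thesis
    by (simp add: distrib_left mult_ac)
qed

end
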